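(* A quasi-Artinian Leibniz algebra is Artinian if and only if every quotient algebra of it satisfies the minimal condition for abelian ideals. Symbolically, $\min\text{-}\lhd=(\min\text{-}\lhd\,\mathfrak{U})^{Q}\cap(q\min\text{-}\lhd)$.
   Context: A (left) Leibniz algebra is a vector space $\mathfrak{g}$ (of arbitrary dimension) over a field with a bilinear bracket satisfying $[x,[y,z]]=[[x,y],z]+[y,[x,z]]$ for all $x,y,z$. "Ideal" means two-sided ideal. For subspaces $A,B$, $[A,B]$ is the linear span of all $[a,b]$, $a\in A$, $b\in B$. The derived series is $\mathfrak{g}^{(0)}=\mathfrak{g}$, $\mathfrak{g}^{(n+1)}=[\mathfrak{g}^{(n)},\mathfrak{g}^{(n)}]$. $\mathfrak{g}$ is left (resp. right) quasi-Artinian if for every descending chain of ideals $I_1\supseteq I_2\supseteq\cdots$ of $\mathfrak{g}$ there is $m\in\mathbb{N}$ such that $[\mathfrak{g}^{(m)},I_m]\subseteq I_n$ (resp. $[I_m,\mathfrak{g}^{(m)}]\subseteq I_n$) for all $n\in\mathbb{N}$; it is quasi-Artinian if it is both. The class of quasi-Artinian Leibniz algebras is $q\min\text{-}\lhd$. $\min\text{-}\lhd$ is the class of Artinian Leibniz algebras, i.e. those in which every descending chain of ideals terminates. An ideal $I$ is abelian if $[I,I]=0$. $\min\text{-}\lhd\,\mathfrak{U}$ is the class of Leibniz algebras in which every descending chain of abelian ideals terminates (minimal condition for abelian ideals). For a class $\mathfrak{X}$, $\mathfrak{X}^{Q}$ is the class of Leibniz algebras $\mathfrak{g}$ such that $\mathfrak{g}/I\in\mathfrak{X}$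 for every ideal $I$ of $\mathfrak{g}$. *)

theory Defs
  imports "HOL-Algebra.QuotRing" "HOL-Algebra.Module" "HOL.Hull"
begin

text \<open>
  A Leibniz algebra is carried by a record of type \<^typ>\<open>('k, 'b) module\<close>: addition, zero and scalar
  multiplication are the vector space structure, and the field \<open>mult\<close> (written \<open>\<otimes>\<close>) is the
  Leibniz bracket. The field \<open>one\<close> of the record plays no role and is unconstrained.
\<close>

locale leibniz_algebra = field K + module K L for K (structure) and L (structure) +
  assumes bracket_closed:
      "\<lbrakk>x \<in> carrier L; y \<in> carrier L\<rbrakk> \<Longrightarrow> x \<otimes>\<^bsub>L\<^esub> y \<in> carrier L"
    and bracket_add_left:
      "\<lbrakk>x \<in> carrier L; y \<in> carrier L; z \<in> carrier L\<rbrakk> \<Longrightarrow>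
       (x \<oplus>\<^bsub>L\<^esub> y) \<otimes>\<^bsub>L\<^esub> z = (x \<otimes>\<^bsub>L\<^esub> z) \<oplus>\<^bsub>L\<^esub> (y \<otimes>\<^bsub>L\<^esub> z)"
    and bracket_add_right:
      "\<lbrakk>x \<in> carrier L; y \<in> carrier L; z \<in> carrier L\<rbrakk> \<Longrightarrow>
       x \<otimes>\<^bsub>L\<^esub> (y \<oplus>\<^bsub>L\<^esub> z) = (x \<otimes>\<^bsub>L\<^esub> y) \<oplus>\<^bsub>L\<^esub> (x \<otimes>\<^bsub>L\<^esub> z)"
    and bracket_smult_left:
      "\<lbrakk>c \<in> carrier K; x \<in> carrier L; y \<in> carrier L\<rbrakk> \<Longrightarrow>
       (c \<odot>\<^bsub>L\<^esub> x) \<otimes>\<^bsub>L\<^esub> y = c \<odot>\<^bsub>L\<^esub> (x \<otimes>\<^bsub>L\<^esub> y)"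
    and bracket_smult_right:
      "\<lbrakk>c \<in> carrier K; x \<in> carrier L; y \<in> carrier L\<rbrakk> \<Longrightarrow>
       x \<otimes>\<^bsub>L\<^esub> (c \<odot>\<^bsub>L\<^esub> y) = c \<odot>\<^bsub>L\<^esub> (x \<otimes>\<^bsub>L\<^esub> y)"
    and leibniz_identity:
      "\<lbrakk>x \<in> carrier L; y \<in> carrier L; z \<in> carrier L\<rbrakk> \<Longrightarrow>
       x \<otimes>\<^bsub>L\<^esub> (y \<otimes>\<^bsub>L\<^esub> z) = ((x \<otimes>\<^bsub>L\<^esub> y) \<otimes>\<^bsub>L\<^esub> z) \<oplus>\<^bsub>L\<^esub> (y \<otimes>\<^bsub>L\<^esub> (x \<otimes>\<^bsub>L\<^esub> z))"

definition leibniz_ideal :: "('k, 'r) ring_scheme \<Rightarrow> ('k, 'b) module \<Rightarrow> 'b set \<Rightarrow> bool" where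
  "leibniz_ideal K L I \<longleftrightarrow> submodule I K L \<and>
     (\<forall>x \<in> carrier L. \<forall>a \<in> I. x \<otimes>\<^bsub>L\<^esub> a \<in> I \<and> a \<otimes>\<^bsub>L\<^esub> x \<in> I)"

definition bracket_span ::
  "('k, 'r) ring_scheme \<Rightarrow> ('k, 'b) module \<Rightarrow> 'b set \<Rightarrow> 'b set \<Rightarrow> 'b set" where
  "bracket_span K L A B = (\<lambda>H. submodule H K L) hull {a \<otimes>\<^bsub>L\<^esub> b | a b. a \<in> A \<and> b \<in> B}"

primrec derived_series ::
  "('k, 'r) ring_scheme \<Rightarrow> ('k, 'b) module \<Rightarrow> nat \<Rightarrow> 'b set" where
  "derived_series K L 0 = carrier L"
| "derived_series K L (Suc n) =
     bracket_span K L (derived_series K L n) (derived_series K L n)"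

definition abelian_ideal :: "('k, 'r) ring_scheme \<Rightarrow> ('k, 'b) module \<Rightarrow> 'b set \<Rightarrow> bool" where
  "abelian_ideal K L I \<longleftrightarrow> leibniz_ideal K L I \<and> bracket_span K L I I = {\<zero>\<^bsub>L\<^esub>}"

text \<open>
  The quotient of \<^term>\<open>L\<close> by an ideal: \<^const>\<open>FactRing\<close> with scalar multiplication of cosets added.
  As with \<^const>\<open>rcoset_mult\<close>, the union ranges over representatives.
\<close>

definition quotient_algebra :: "('k, 'b) module \<Rightarrow> 'b set \<Rightarrow> ('k, 'b set) module" where
  "quotient_algebra L I =
    \<lparr>carrier = a_rcosets\<^bsub>L\<^esub> I, mult = rcoset_mult L I, one = I +>\<^bsub>L\<^esub> \<one>\<^bsub>L\<^esub>,
     zero = I, add = set_add L, smult = (\<lambda>c X. \<Union>x\<in>X. I +>\<^bsub>L\<^esub> (c \<odot>\<^bsub>L\<^esub> x))\<rparr>"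

text \<open>Chains are indexed from 1, so the value at index 0 is irrelevant.\<close>

definition descending_chain :: "('b set \<Rightarrow> bool) \<Rightarrow> (nat \<Rightarrow> 'b set) \<Rightarrow> bool" where
  "descending_chain P I \<longleftrightarrow> (\<forall>n\<ge>1. P (I n)) \<and> (\<forall>n\<ge>1. I (Suc n) \<subseteq> I n)"

definition terminates :: "(nat \<Rightarrow> 'b set) \<Rightarrow> bool" where
  "terminates I \<longleftrightarrow> (\<exists>m\<ge>1. \<forall>n\<ge>m. I n = I m)"

definition left_quasi_artinian :: "('k, 'r) ring_scheme \<Rightarrow> ('k, 'b) module \<Rightarrow> bool" where
  "left_quasi_artinian K L \<longleftrightarrow>
     (\<forall>I. descending_chain (leibniz_ideal K L) I \<longrightarrow>
       (\<exists>m\<ge>1. \<forall>n\<ge>1. bracket_span K L (derived_series K L m) (I m) \<subseteq> I n))"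

definition right_quasi_artinian :: "('k, 'r) ring_scheme \<Rightarrow> ('k, 'b) module \<Rightarrow> bool" where
  "right_quasi_artinian K L \<longleftrightarrow>
     (\<forall>I. descending_chain (leibniz_ideal K L) I \<longrightarrow>
       (\<exists>m\<ge>1. \<forall>n\<ge>1. bracket_span K L (I m) (derived_series K L m) \<subseteq> I n))"

text \<open>
  Classes of Leibniz algebras over \<^term>\<open>K\<close> are sets of records. The first three are
  \<open>q min-\<lhd>\<close>, \<open>min-\<lhd>\<close> and \<open>min-\<lhd> U\<close>; the last is the operator taking \<open>X\<close> to \<open>X\<^sup>Q\<close>. Since a quotient of
  an algebra on \<^typ>\<open>'b\<close> lives on \<^typ>\<open>'b set\<close>, the argument of the operator is the instance of the
  class at the latter type.
\<close>

definition quasi_artinian_class :: "('k, 'r) ring_scheme \<Rightarrow> ('k, 'b) module set" where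
  "quasi_artinian_class K =
     {L. leibniz_algebra K L \<and> left_quasi_artinian K L \<and> right_quasi_artinian K L}"

definition artinian_class :: "('k, 'r) ring_scheme \<Rightarrow> ('k, 'b) module set" where
  "artinian_class K =
     {L. leibniz_algebra K L \<and> (\<forall>I. descending_chain (leibniz_ideal K L) I \<longrightarrow> terminates I)}"

definition min_abelian_class :: "('k, 'r) ring_scheme \<Rightarrow> ('k, 'b) module set" where
  "min_abelian_class K =
     {L. leibniz_algebra K L \<and> (\<forall>I. descending_chain (abelian_ideal K L) I \<longrightarrow> terminates I)}"

definition quotient_class ::
  "('k, 'r) ring_scheme \<Rightarrow> ('k, 'b set) module set \<Rightarrow> ('k, 'b) module set" where
  "quotient_class K X =
     {L. leibniz_algebra K L \<and> (\<forall>I. leibniz_ideal K L I \<longrightarrow> quotient_algebra L I \<in> X)}"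

end

theory Submission
  imports Defs
begin

text \<open>
  Write \<open>D\<^sub>k\<close> for the derived series. Let \<open>I\<^sub>n\<close> be a descending chain of ideals with intersection
  \<open>J\<close>, and let \<open>m\<close> be such that \<open>[D\<^sub>m, I\<^sub>m] \<subseteq> J\<close>. The ideals \<open>(I\<^sub>n \<inter> D\<^sub>m) + J\<close> with \<open>n \<ge> m\<close> are abelian
  modulo \<open>J\<close>, so they stabilise, and as \<open>I\<^sub>n \<inter> D\<^sub>m \<inter> J = D\<^sub>m \<inter> J\<close>, the modular law shows that
  \<open>I\<^sub>n \<inter> D\<^sub>m\<close> stabilises. Likewise \<open>(I\<^sub>n \<inter> D\<^sub>k) + D\<^sub>k\<^sub>+\<^sub>1\<close> is abelian modulo \<open>D\<^sub>k\<^sub>+\<^sub>1\<close>, so if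
  \<open>I\<^sub>n \<inter> D\<^sub>k\<^sub>+\<^sub>1\<close> stabilises, then so does \<open>I\<^sub>n \<inter> D\<^sub>k\<close>; descend from \<open>k = m\<close> to \<open>k = 0\<close>.
\<close>

section \<open>Descending chains\<close>

lemma descending_chain_antimono:
  assumes "descending_chain P C" "1 \<le> m" "m \<le> n"
  shows "C n \<subseteq> C m"
  using assms(3,2)
proof (induction n rule: dec_induct)
  case (step n)
  then have "C (Suc n) \<subseteq> C n"
    using assms(1) by (simp add: descending_chain_def)
  with step show ?case by blast
qed simp

text \<open>Re-indexing only moves the threshold by \<open>k\<close>. A chain may thus be studied
  from an index onwards at which more is known about its members.\<close>

lemma terminates_shift:
  assumes "terminates (\<lambda>n. C (n + k))"
  shows "terminates C"
proof -
  obtain m where m: "m \<ge> 1" "\<And>n. n \<ge> m \<Longrightarrow> C (n + k) = C (m + k)"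
    using assms unfolding terminates_def by blast
  have "C n = C (m + k)" if "n \<ge> m + k" for n
  proof -
    have "n - k \<ge> m" "n - k + k = n" using that by linarith+
    then show ?thesis using m(2)[of "n - k"] by metis
  qed
  moreover have "m + k \<ge> 1" using m(1) by simp
  ultimately show ?thesis
    unfolding terminates_def by blast
qed

text \<open>Stability is inherited by whatever is computed memberwise from a stable chain. In the
  quotient arguments \<open>f\<close> is the image or the preimage under the projection.\<close>

lemma terminates_cong:
  assumes "terminates C" "\<And>n. n \<ge> 1 \<Longrightarrow> D n = f (C n)"
  shows "terminates D"
proof -
  obtain m where m: "m \<ge> 1" "\<And>n. n \<ge> m \<Longrightarrow> C n = C m"
    using assms(1) unfolding terminates_def by blast
  have "D n = D m" if "n \<ge> m" for n
    using m(1) m(2)[OF that] that assms(2)[of n] assms(2)[of m] by simp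
  then show ?thesis
    unfolding terminates_def using m(1) by blast
qed

section \<open>Ideals\<close>

lemma (in module) submoduleI_nonempty:
  assumes "H \<subseteq> carrier M" "H \<noteq> {}"
    and "\<And>a b. \<lbrakk>a \<in> H; b \<in> H\<rbrakk> \<Longrightarrow> a \<oplus>\<^bsub>M\<^esub> b \<in> H"
    and smult: "\<And>c a. \<lbrakk>c \<in> carrier R; a \<in> H\<rbrakk> \<Longrightarrow> c \<odot>\<^bsub>M\<^esub> a \<in> H"
  shows "submodule H R M"
proof (rule submoduleI)
  \<comment> \<open>Zero and negatives come from scalars: \<open>0\<close> times a member and
    \<open>-1\<close> times a member.\<close>
  show "\<zero>\<^bsub>M\<^esub> \<in> H"
  proof -
    obtain a where "a \<in> H" using assms(2) by blast
    then show ?thesis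
      using smult[OF R.zero_closed, of a] smult_l_null[of a] assms(1) by auto
  qed
  show "\<ominus>\<^bsub>M\<^esub> a \<in> H" if "a \<in> H" for a
    using smult[OF R.a_inv_closed[OF R.one_closed] that] smult_l_minus[OF R.one_closed, of a]
      smult_one[of a] that assms(1) by auto
qed (use assms in auto)

lemma (in module) submodule_zero:
  assumes "submodule H R M"
  shows "\<zero>\<^bsub>M\<^esub> \<in> H"
  using subgroup.one_closed[OF submodule.axioms(1)[OF assms]] by simp

lemma (in module) submodule_Inter:
  assumes "S \<noteq> {}" "\<And>H. H \<in> S \<Longrightarrow> submodule H R M"
  shows "submodule (\<Inter>S) R M"
proof (rule submoduleI_nonempty)
  show "\<Inter>S \<subseteq> carrier M"
    using assms submoduleE(1) by blast
  show "\<Inter>S \<noteq> {}"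
    using submodule_zero[OF assms(2)] by blast
  show "a \<oplus>\<^bsub>M\<^esub> b \<in> \<Inter>S" if "a \<in> \<Inter>S" "b \<in> \<Inter>S" for a b
    using submoduleE(5)[OF assms(2)] that by blast
  show "c \<odot>\<^bsub>M\<^esub> a \<in> \<Inter>S" if "c \<in> carrier R" "a \<in> \<Inter>S" for c a
    using submoduleE(4)[OF assms(2)] that by blast
qed

lemma (in module) set_add_iff:
  "x \<in> A <+>\<^bsub>M\<^esub> B \<longleftrightarrow> (\<exists>a\<in>A. \<exists>b\<in>B. x = a \<oplus>\<^bsub>M\<^esub> b)"
  by (auto simp: set_add_def set_mult_def)

lemma (in module) submodule_set_add:
  assumes "submodule A R M" "submodule B R M"
  shows "submodule (A <+>\<^bsub>M\<^esub> B) R M"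
proof (rule submoduleI_nonempty)
  note A = submoduleE[OF assms(1)] and B = submoduleE[OF assms(2)]
  show "A <+>\<^bsub>M\<^esub> B \<subseteq> carrier M"
    using A(1) B(1) by (auto simp: set_add_iff subset_iff)
  show "A <+>\<^bsub>M\<^esub> B \<noteq> {}"
    using A(2) B(2) by (auto simp: set_add_def set_mult_def)
  show "x \<oplus>\<^bsub>M\<^esub> y \<in> A <+>\<^bsub>M\<^esub> B" if xy: "x \<in> A <+>\<^bsub>M\<^esub> B" "y \<in> A <+>\<^bsub>M\<^esub> B" for x y
  proof -
    obtain a b a' b' where e: "a \<in> A" "b \<in> B" "x = a \<oplus>\<^bsub>M\<^esub> b" "a' \<in> A" "b' \<in> B" "y = a' \<oplus>\<^bsub>M\<^esub> b'"
      using xy by (auto simp: set_add_iff)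
    then have "x \<oplus>\<^bsub>M\<^esub> y = (a \<oplus>\<^bsub>M\<^esub> a') \<oplus>\<^bsub>M\<^esub> (b \<oplus>\<^bsub>M\<^esub> b')"
      using A(1) B(1) by (auto simp: subset_iff M.a_ac)
    then show ?thesis
      unfolding set_add_iff using A(5) B(5) e by blast
  qed
  show "c \<odot>\<^bsub>M\<^esub> x \<in> A <+>\<^bsub>M\<^esub> B" if c: "c \<in> carrier R" and x: "x \<in> A <+>\<^bsub>M\<^esub> B" for c x
  proof -
    obtain a b where e: "a \<in> A" "b \<in> B" "x = a \<oplus>\<^bsub>M\<^esub> b"
      using x by (auto simp: set_add_iff)
    then have "c \<odot>\<^bsub>M\<^esub> x = c \<odot>\<^bsub>M\<^esub> a \<oplus>\<^bsub>M\<^esub> c \<odot>\<^bsub>M\<^esub> b"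
      using A(1) B(1) c by (auto simp: smult_r_distr subset_iff)
    then show ?thesis
      unfolding set_add_iff using A(4) B(4) e c by blast
  qed
qed

lemma (in module) subset_set_add:
  assumes "submodule A R M" "submodule B R M"
  shows "A \<subseteq> A <+>\<^bsub>M\<^esub> B" "B \<subseteq> A <+>\<^bsub>M\<^esub> B"
proof -
  note A = submoduleE(1)[OF assms(1)] and B = submoduleE(1)[OF assms(2)]
  show "A \<subseteq> A <+>\<^bsub>M\<^esub> B"
  proof
    fix a assume "a \<in> A"
    then show "a \<in> A <+>\<^bsub>M\<^esub> B"
      unfolding set_add_iff using A submodule_zero[OF assms(2)] M.r_zero[of a] by (metis subsetD)
  qed
  show "B \<subseteq> A <+>\<^bsub>M\<^esub> B"
  proof
    fix b assume "b \<in> B"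
    then show "b \<in> A <+>\<^bsub>M\<^esub> B"
      unfolding set_add_iff using B submodule_zero[OF assms(1)] M.l_zero[of b] by (metis subsetD)
  qed
qed

text \<open>Write \<open>a = a' + b\<close>. Then \<open>b = a - a'\<close> lies in
  \<open>A \<inter> B\<close> because \<open>A' \<subseteq> A\<close>, hence in \<open>A'\<close>,
  and so does \<open>a\<close>. The form is suited to comparing two members of a descending
  chain.\<close>

lemma (in module) submodule_modular_eq:
  assumes "submodule A R M" "submodule A' R M" "submodule B R M"
    and "A' \<subseteq> A" "A \<inter> B = A' \<inter> B" "A <+>\<^bsub>M\<^esub> B = A' <+>\<^bsub>M\<^esub> B"
  shows "A = A'"
proof
  show "A \<subseteq> A'"
  proof
    fix a assume a: "a \<in> A"
    then obtain a' b where e: "a' \<in> A'" "b \<in> B" "a = a' \<oplus>\<^bsub>M\<^esub> b"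
      using subset_set_add(1)[OF assms(1,3)] assms(6) by (metis set_add_iff subsetD)
    have c: "a' \<in> carrier M" "b \<in> carrier M"
      using e submoduleE(1)[OF assms(2)] submoduleE(1)[OF assms(3)] by auto
    have "\<ominus>\<^bsub>M\<^esub> a' \<oplus>\<^bsub>M\<^esub> a \<in> A"
      using a e(1) assms(4) submoduleE(3,5)[OF assms(1)] by blast
    moreover have "\<ominus>\<^bsub>M\<^esub> a' \<oplus>\<^bsub>M\<^esub> a = b"
      using c e(3) by (simp add: M.r_neg1)
    ultimately have "b \<in> A'"
      using e(2) assms(5) by blast
    then show "a \<in> A'"
      using e submoduleE(5)[OF assms(2)] by blast
  qed
qed (rule assms(4))

text \<open>\<^const>\<open>leibniz_ideal\<close> and \<^const>\<open>quotient_algebra\<close> only apply to records without further fields.\<close>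

locale plain_leibniz_algebra = leibniz_algebra K L
  for K :: "('k, 'r) ring_scheme" (structure) and L :: "('k, 'b) module" (structure)
begin

lemma bracket_zero_left: "x \<in> carrier L \<Longrightarrow> \<zero>\<^bsub>L\<^esub> \<otimes>\<^bsub>L\<^esub> x = \<zero>\<^bsub>L\<^esub>"
  using bracket_smult_left[of \<zero> "\<zero>\<^bsub>L\<^esub>" x] bracket_closed by simp

lemma bracket_zero_right: "x \<in> carrier L \<Longrightarrow> x \<otimes>\<^bsub>L\<^esub> \<zero>\<^bsub>L\<^esub> = \<zero>\<^bsub>L\<^esub>"
  using bracket_smult_right[of \<zero> x "\<zero>\<^bsub>L\<^esub>"] bracket_closed by simp

lemma idealD:
  assumes "leibniz_ideal K L I"
  shows "submodule I K L"
    and "x \<in> I \<Longrightarrow> x \<in> carrier L"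
    and "\<lbrakk>x \<in> carrier L; a \<in> I\<rbrakk> \<Longrightarrow> x \<otimes>\<^bsub>L\<^esub> a \<in> I"
    and "\<lbrakk>x \<in> carrier L; a \<in> I\<rbrakk> \<Longrightarrow> a \<otimes>\<^bsub>L\<^esub> x \<in> I"
  using assms submoduleE(1)[of I] unfolding leibniz_ideal_def by blast+

lemma ideal_carrier: "leibniz_ideal K L (carrier L)"
  using carrier_is_submodule bracket_closed by (simp add: leibniz_ideal_def)

lemma ideal_Inter:
  assumes "S \<noteq> {}" "\<And>I. I \<in> S \<Longrightarrow> leibniz_ideal K L I"
  shows "leibniz_ideal K L (\<Inter>S)"
  using submodule_Inter[of S] assms by (auto simp: leibniz_ideal_def)

lemma ideal_inter:
  "\<lbrakk>leibniz_ideal K L I; leibniz_ideal K L J\<rbrakk> \<Longrightarrow> leibniz_ideal K L (I \<inter> J)"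
  using ideal_Inter[of "{I, J}"] by auto

lemma ideal_set_add:
  assumes I: "leibniz_ideal K L I" and J: "leibniz_ideal K L J"
  shows "leibniz_ideal K L (I <+>\<^bsub>L\<^esub> J)"
proof -
  have "x \<otimes>\<^bsub>L\<^esub> w \<in> I <+>\<^bsub>L\<^esub> J \<and> w \<otimes>\<^bsub>L\<^esub> x \<in> I <+>\<^bsub>L\<^esub> J"
    if x: "x \<in> carrier L" and w: "w \<in> I <+>\<^bsub>L\<^esub> J" for x w
  proof -
    obtain a b where e: "a \<in> I" "b \<in> J" "w = a \<oplus>\<^bsub>L\<^esub> b"
      using w by (auto simp: set_add_iff)
    then have "x \<otimes>\<^bsub>L\<^esub> w = x \<otimes>\<^bsub>L\<^esub> a \<oplus>\<^bsub>L\<^esub> x \<otimes>\<^bsub>L\<^esub> b" "w \<otimes>\<^bsub>L\<^esub> x = a \<otimes>\<^bsub>L\<^esub> x \<oplus>\<^bsub>L\<^esub> b \<otimes>\<^bsub>L\<^esub> x"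
      using x idealD(2)[OF I] idealD(2)[OF J] bracket_add_left bracket_add_right by auto
    then show ?thesis
      unfolding set_add_iff using e x idealD(3,4)[OF I] idealD(3,4)[OF J] by blast
  qed
  then show ?thesis
    using submodule_set_add idealD(1) I J by (simp add: leibniz_ideal_def)
qed

section \<open>Spans of brackets and the derived series\<close>

lemma bracket_span_contains:
  "\<lbrakk>a \<in> A; b \<in> B\<rbrakk> \<Longrightarrow> a \<otimes>\<^bsub>L\<^esub> b \<in> bracket_span K L A B"
  unfolding bracket_span_def by (rule hull_inc) blast

lemma bracket_span_subset:
  assumes "submodule H K L" "\<And>a b. \<lbrakk>a \<in> A; b \<in> B\<rbrakk> \<Longrightarrow> a \<otimes>\<^bsub>L\<^esub> b \<in> H"
  shows "bracket_span K L A B \<subseteq> H"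
  unfolding bracket_span_def using assms by (intro hull_minimal) auto

lemma submodule_bracket_span:
  assumes "A \<subseteq> carrier L" "B \<subseteq> carrier L"
  shows "submodule (bracket_span K L A B) K L"
  unfolding bracket_span_def hull_def
proof (rule submodule_Inter)
  \<comment> \<open>The hull is the intersection of this family, and an empty family would give the
    whole type. The carrier is a member because it contains \<open>A\<close> and \<open>B\<close>
    and is closed under brackets.\<close>
  show "{H. submodule H K L \<and> {a \<otimes>\<^bsub>L\<^esub> b |a b. a \<in> A \<and> b \<in> B} \<subseteq> H} \<noteq> {}"
    using carrier_is_submodule assms bracket_closed by blast
qed blast

text \<open>The two factors must agree: in a left Leibniz algebra \<open>[A, B]\<close> need not be closed under
  right multiplication, because \<open>[[a, b], x] = [a, [b, x]] - [b, [a, x]]\<close>.\<close>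

lemma ideal_bracket_span:
  assumes A: "leibniz_ideal K L A"
  shows "leibniz_ideal K L (bracket_span K L A A)"
proof -
  let ?S = "bracket_span K L A A"
  have sub: "A \<subseteq> carrier L" using idealD(2)[OF A] by blast
  have S: "submodule ?S K L" by (rule submodule_bracket_span[OF sub sub])
  note SE = submoduleE[OF S]
  have "x \<otimes>\<^bsub>L\<^esub> w \<in> ?S \<and> w \<otimes>\<^bsub>L\<^esub> x \<in> ?S" if x: "x \<in> carrier L" and w: "w \<in> ?S" for x w
  proof -
    \<comment> \<open>Induction over the span: the elements whose brackets with \<open>x\<close> on
      both sides stay in \<open>?S\<close> form a submodule. It contains the generators, hence all
      of \<open>?S\<close>.\<close>
    let ?H = "{w \<in> carrier L. x \<otimes>\<^bsub>L\<^esub> w \<in> ?S \<and> w \<otimes>\<^bsub>L\<^esub> x \<in> ?S}"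
    have "submodule ?H K L"
    proof (rule submoduleI_nonempty)
      have "\<zero>\<^bsub>L\<^esub> \<in> ?H"
        using x submodule_zero[OF S] by (simp add: bracket_zero_left bracket_zero_right)
      then show "?H \<noteq> {}" by blast
    qed (use x SE(4,5) in \<open>auto simp: bracket_add_left bracket_add_right
           bracket_smult_left bracket_smult_right\<close>)
    moreover have "a \<otimes>\<^bsub>L\<^esub> b \<in> ?H" if "a \<in> A" "b \<in> A" for a b
    proof -
      have c: "a \<in> carrier L" "b \<in> carrier L" using that sub by auto
      have "x \<otimes>\<^bsub>L\<^esub> (a \<otimes>\<^bsub>L\<^esub> b) \<in> ?S"
        unfolding leibniz_identity[OF x c]
        using that idealD(3)[OF A x] by (intro SE(5) bracket_span_contains)
      moreover have "(a \<otimes>\<^bsub>L\<^esub> b) \<otimes>\<^bsub>L\<^esub> x \<in> ?S"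
      proof -
        have "(a \<otimes>\<^bsub>L\<^esub> b) \<otimes>\<^bsub>L\<^esub> x
            = a \<otimes>\<^bsub>L\<^esub> (b \<otimes>\<^bsub>L\<^esub> x) \<oplus>\<^bsub>L\<^esub> \<ominus>\<^bsub>L\<^esub> (b \<otimes>\<^bsub>L\<^esub> (a \<otimes>\<^bsub>L\<^esub> x))"
          using leibniz_identity[OF c x] c x bracket_closed
          by (simp add: M.a_assoc M.r_neg)
        then show ?thesis
          using that idealD(4)[OF A x] by (auto intro: SE(3,5) bracket_span_contains)
      qed
      ultimately show ?thesis using c bracket_closed by simp
    qed
    ultimately show ?thesis using bracket_span_subset[of ?H A A] w by blast
  qed
  then show ?thesis using S by (simp add: leibniz_ideal_def)
qed

lemma ideal_derived_series: "leibniz_ideal K L (derived_series K L n)"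
  by (induction n) (simp_all add: ideal_carrier ideal_bracket_span)

lemma derived_series_Suc_subset: "derived_series K L (Suc n) \<subseteq> derived_series K L n"
  using idealD[OF ideal_derived_series[of n]]
  by (simp add: bracket_span_subset)

end

section \<open>Quotient algebras\<close>

locale leibniz_quotient = plain_leibniz_algebra +
  fixes I
  assumes ideal: "leibniz_ideal K L I"
begin

abbreviation Q where "Q \<equiv> quotient_algebra L I"
abbreviation proj where "proj x \<equiv> I +>\<^bsub>L\<^esub> x"

sublocale cosets: abelian_subgroup I L
  using idealD(1)[OF ideal] M.abelian_group_axioms
  by (intro abelian_subgroupI3 additive_subgroupI) (auto simp: submodule_def)

section \<open>Coset representatives and the operations of the quotient\<close>

lemma proj_iff:
  "\<lbrakk>x \<in> carrier L; y \<in> carrier L\<rbrakk> \<Longrightarrow> y \<in> proj x \<longleftrightarrow> (\<exists>i\<in>I. y = i \<oplus>\<^bsub>L\<^esub> x)"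
  by (auto simp: a_r_coset_def')

lemma proj_eqI: "\<lbrakk>x \<in> carrier L; i \<in> I\<rbrakk> \<Longrightarrow> proj (i \<oplus>\<^bsub>L\<^esub> x) = proj x"
  by (rule cosets.a_repr_independence'[symmetric]) (auto simp: a_r_coset_def')

lemma proj_eq_iff:
  assumes "x \<in> carrier L" "y \<in> carrier L"
  shows "proj x = proj y \<longleftrightarrow> (\<exists>i\<in>I. x = i \<oplus>\<^bsub>L\<^esub> y)"
  using assms proj_eqI cosets.a_rcos_self proj_iff by metis

lemma carrier_Q: "carrier Q = proj ` carrier L"
  by (auto simp: quotient_algebra_def A_RCOSETS_def')

lemma zero_Q: "\<zero>\<^bsub>Q\<^esub> = proj \<zero>\<^bsub>L\<^esub>"
  using cosets.a_subset by (simp add: quotient_algebra_def)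

lemma add_Q: "\<lbrakk>x \<in> carrier L; y \<in> carrier L\<rbrakk> \<Longrightarrow> proj x \<oplus>\<^bsub>Q\<^esub> proj y = proj (x \<oplus>\<^bsub>L\<^esub> y)"
  by (simp add: quotient_algebra_def cosets.a_rcos_sum)

text \<open>\<open>rcoset_mult\<close> is a union over representatives, so the point is that all
  cosets in it agree. For \<open>a = i + x\<close> and \<open>b = j + y\<close> the bracket
  \<open>[a, b]\<close> differs from \<open>[x, y]\<close> by \<open>[i, b] + [x, j]\<close>, which
  lies in the two-sided ideal \<open>I\<close>.\<close>

lemma bracket_Q:
  assumes "x \<in> carrier L" "y \<in> carrier L"
  shows "proj x \<otimes>\<^bsub>Q\<^esub> proj y = proj (x \<otimes>\<^bsub>L\<^esub> y)"
proof -
  have "proj (a \<otimes>\<^bsub>L\<^esub> b) = proj (x \<otimes>\<^bsub>L\<^esub> y)" if ab: "a \<in> proj x" "b \<in> proj y" for a b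
  proof -
    obtain i j where e: "i \<in> I" "a = i \<oplus>\<^bsub>L\<^esub> x" "j \<in> I" "b = j \<oplus>\<^bsub>L\<^esub> y"
      using ab by (auto simp: a_r_coset_def')
    have c: "i \<in> carrier L" "j \<in> carrier L" using e idealD(2)[OF ideal] by auto
    have "a \<otimes>\<^bsub>L\<^esub> b = (i \<otimes>\<^bsub>L\<^esub> b \<oplus>\<^bsub>L\<^esub> x \<otimes>\<^bsub>L\<^esub> j) \<oplus>\<^bsub>L\<^esub> x \<otimes>\<^bsub>L\<^esub> y"
      using c e assms bracket_closed
      by (simp add: bracket_add_left bracket_add_right M.a_ac)
    moreover have "i \<otimes>\<^bsub>L\<^esub> b \<oplus>\<^bsub>L\<^esub> x \<otimes>\<^bsub>L\<^esub> j \<in> I"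
      using c e assms idealD(3,4)[OF ideal] by simp
    ultimately show ?thesis using proj_eqI assms bracket_closed by simp
  qed
  then have "proj x \<otimes>\<^bsub>Q\<^esub> proj y = (\<Union>a\<in>proj x. \<Union>b\<in>proj y. proj (x \<otimes>\<^bsub>L\<^esub> y))"
    by (simp add: quotient_algebra_def rcoset_mult_def)
  \<comment> \<open>Each coset contains its representative, so both index sets are inhabited and the
    constant union collapses.\<close>
  then show ?thesis using cosets.a_rcos_self assms by auto
qed

lemma smult_Q:
  assumes "c \<in> carrier K" "x \<in> carrier L"
  shows "c \<odot>\<^bsub>Q\<^esub> proj x = proj (c \<odot>\<^bsub>L\<^esub> x)"
proof -
  have "proj (c \<odot>\<^bsub>L\<^esub> a) = proj (c \<odot>\<^bsub>L\<^esub> x)" if a: "a \<in> proj x" for a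
  proof -
    obtain i where e: "i \<in> I" "a = i \<oplus>\<^bsub>L\<^esub> x"
      using a by (auto simp: a_r_coset_def')
    then show ?thesis
      using assms idealD(2)[OF ideal] submoduleE(4)[OF idealD(1)[OF ideal]]
      by (simp add: smult_r_distr proj_eqI)
  qed
  then have "c \<odot>\<^bsub>Q\<^esub> proj x = (\<Union>a\<in>proj x. proj (c \<odot>\<^bsub>L\<^esub> x))"
    by (simp add: quotient_algebra_def)
  then show ?thesis using cosets.a_rcos_self assms by auto
qed

lemmas Q_simps = add_Q bracket_Q smult_Q

lemma quotient_leibniz_algebra: "leibniz_algebra K Q"
proof -
  have "abelian_group Q"
  proof (rule abelian_groupI)
    show "\<exists>y\<in>carrier Q. y \<oplus>\<^bsub>Q\<^esub> x = \<zero>\<^bsub>Q\<^esub>" if x: "x \<in> carrier Q" for x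
    proof -
      obtain a where a: "a \<in> carrier L" "x = proj a" using x carrier_Q by auto
      then have "proj (\<ominus>\<^bsub>L\<^esub> a) \<oplus>\<^bsub>Q\<^esub> x = \<zero>\<^bsub>Q\<^esub>" by (simp add: Q_simps zero_Q M.l_neg)
      then show ?thesis using a carrier_Q by blast
    qed
  qed (auto simp: carrier_Q zero_Q Q_simps M.a_ac)
  then have "module K Q"
    by (rule moduleI[OF cring_axioms])
      (auto simp: carrier_Q Q_simps smult_l_distr smult_r_distr smult_assoc1)
  moreover have "leibniz_algebra_axioms K Q"
  proof
    fix x y z assume "x \<in> carrier Q" "y \<in> carrier Q" "z \<in> carrier Q"
    then obtain a b c where "x = proj a" "a \<in> carrier L" "y = proj b" "b \<in> carrier L"
        "z = proj c" "c \<in> carrier L"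
      by (auto simp: carrier_Q)
    then show "x \<otimes>\<^bsub>Q\<^esub> (y \<otimes>\<^bsub>Q\<^esub> z) = ((x \<otimes>\<^bsub>Q\<^esub> y) \<otimes>\<^bsub>Q\<^esub> z) \<oplus>\<^bsub>Q\<^esub> (y \<otimes>\<^bsub>Q\<^esub> (x \<otimes>\<^bsub>Q\<^esub> z))"
      using leibniz_identity[of a b c] by (simp add: Q_simps bracket_closed)
  qed (auto simp: carrier_Q Q_simps bracket_closed bracket_add_left bracket_add_right
        bracket_smult_left bracket_smult_right)
  ultimately show ?thesis
    using field_axioms by (simp add: leibniz_algebra_def)
qed

section \<open>Ideals and chains under the projection\<close>

lemma ideal_image:
  assumes A: "leibniz_ideal K L A"
  shows "leibniz_ideal K Q (proj ` A)"
proof -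
  interpret Q: plain_leibniz_algebra K Q
    by (intro plain_leibniz_algebra.intro quotient_leibniz_algebra)
  note AD = idealD[OF A] submoduleE[OF idealD(1)[OF A]]
  have "submodule (proj ` A) K Q"
    by (rule Q.submoduleI_nonempty) (use AD in \<open>auto simp: carrier_Q Q_simps\<close>)
  then show ?thesis
    using AD by (auto simp: leibniz_ideal_def carrier_Q Q_simps)
qed

lemma ideal_vimage:
  assumes B: "leibniz_ideal K Q B"
  shows "leibniz_ideal K L {x \<in> carrier L. proj x \<in> B}"
proof -
  interpret Q: plain_leibniz_algebra K Q
    by (intro plain_leibniz_algebra.intro quotient_leibniz_algebra)
  note BD = Q.idealD[OF B] Q.submoduleE[OF Q.idealD(1)[OF B]]
  have "submodule {x \<in> carrier L. proj x \<in> B} K L"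
  proof (rule submoduleI_nonempty)
    show "{x \<in> carrier L. proj x \<in> B} \<noteq> {}"
      using Q.submodule_zero[OF BD(1)] zero_Q by auto
  qed (use BD in \<open>auto simp: Q_simps[symmetric]\<close>)
  then show ?thesis
    using BD by (auto simp: leibniz_ideal_def carrier_Q Q_simps[symmetric] bracket_closed)
qed

text \<open>If \<open>proj x = proj a\<close> with \<open>a \<in> A\<close>, then
  \<open>x = i + a\<close> for some \<open>i \<in> I \<subseteq> A\<close>. So \<open>A\<close> is a
  union of cosets and no information is lost in its image.\<close>

lemma vimage_image:
  assumes "leibniz_ideal K L A" "I \<subseteq> A"
  shows "{x \<in> carrier L. proj x \<in> proj ` A} = A"
proof -
  note AD = idealD(2)[OF assms(1)] submoduleE(5)[OF idealD(1)[OF assms(1)]]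
  have "x \<in> A" if "x \<in> carrier L" "a \<in> A" "proj x = proj a" for x a
    using proj_eq_iff[of x a] that AD assms(2) by blast
  then show ?thesis using AD(1) by blast
qed

text \<open>The chain is pulled back to \<open>L\<close>, where it stabilises. As the projection is
  surjective, each \<open>D n\<close> is the image of its preimage.\<close>

lemma artinian_quotient:
  assumes "\<And>C. descending_chain (leibniz_ideal K L) C \<Longrightarrow> terminates C"
    and "descending_chain (leibniz_ideal K Q) D"
  shows "terminates D"
proof (rule terminates_cong)
  interpret Q: plain_leibniz_algebra K Q
    by (intro plain_leibniz_algebra.intro quotient_leibniz_algebra)
  let ?C = "\<lambda>n. {x \<in> carrier L. proj x \<in> D n}"
  show "terminates ?C"
    using assms(2) ideal_vimage by (intro assms(1)) (auto simp: descending_chain_def)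
  show "D n = proj ` ?C n" if "n \<ge> 1" for n
    using Q.idealD(2)[of "D n"] assms(2) that by (auto simp: descending_chain_def carrier_Q)
qed

text \<open>By \<open>brackets\<close> the images in \<open>Q\<close> are abelian ideals, so
  \<open>min\<close> applies to them. By \<open>above\<close> each \<open>C n\<close> is recovered
  as the preimage of its image.\<close>

lemma terminates_if_abelian_mod:
  assumes min: "\<And>D. descending_chain (abelian_ideal K Q) D \<Longrightarrow> terminates D"
    and C: "descending_chain (leibniz_ideal K L) C"
    and above: "\<And>n. n \<ge> 1 \<Longrightarrow> I \<subseteq> C n"
    and brackets: "\<And>n a b. \<lbrakk>n \<ge> 1; a \<in> C n; b \<in> C n\<rbrakk> \<Longrightarrow> a \<otimes>\<^bsub>L\<^esub> b \<in> I"
  shows "terminates C"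
proof (rule terminates_cong)
  interpret Q: plain_leibniz_algebra K Q
    by (intro plain_leibniz_algebra.intro quotient_leibniz_algebra)
  have id: "leibniz_ideal K L (C n)" if "n \<ge> 1" for n
    using C that by (simp add: descending_chain_def)
  have zero_submodule: "submodule {\<zero>\<^bsub>Q\<^esub>} K Q"
    by (rule Q.submoduleI_nonempty) auto
  have "abelian_ideal K Q (proj ` C n)" if n: "n \<ge> 1" for n
  proof -
    have CL: "C n \<subseteq> carrier L" using idealD(2)[OF id[OF n]] by blast
    have "proj a \<otimes>\<^bsub>Q\<^esub> proj b \<in> {\<zero>\<^bsub>Q\<^esub>}" if "a \<in> C n" "b \<in> C n" for a b
    proof -
      have ab: "a \<otimes>\<^bsub>L\<^esub> b \<in> I" using brackets n that by blast
      then have "proj (a \<otimes>\<^bsub>L\<^esub> b) = proj \<zero>\<^bsub>L\<^esub>"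
        using proj_eqI[OF M.zero_closed ab] idealD(2)[OF ideal] by simp
      moreover have "proj a \<otimes>\<^bsub>Q\<^esub> proj b = proj (a \<otimes>\<^bsub>L\<^esub> b)"
        using that CL by (intro bracket_Q) auto
      ultimately show ?thesis by (simp add: zero_Q)
    qed
    then have "bracket_span K Q (proj ` C n) (proj ` C n) \<subseteq> {\<zero>\<^bsub>Q\<^esub>}"
      by (intro Q.bracket_span_subset[OF zero_submodule]) auto
    \<comment> \<open>\<open>abelian_ideal\<close> asks for equality with the zero submodule, so the
      reverse inclusion is due as well.\<close>
    moreover have "\<zero>\<^bsub>Q\<^esub> \<in> bracket_span K Q (proj ` C n) (proj ` C n)"
      using CL by (intro Q.submodule_zero Q.submodule_bracket_span) (auto simp: carrier_Q)
    ultimately show ?thesis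
      using ideal_image[OF id[OF n]] by (auto simp: abelian_ideal_def)
  qed
  then show "terminates (\<lambda>n. proj ` C n)"
    using C by (intro min) (auto simp: descending_chain_def intro!: image_mono)
  show "C n = {x \<in> carrier L. proj x \<in> proj ` C n}" if "n \<ge> 1" for n
    using vimage_image[OF id[OF that] above[OF that]] by simp
qed

end

section \<open>The minimal condition on ideals\<close>

context plain_leibniz_algebra
begin

text \<open>The members of \<open>C\<close> need not contain \<open>J\<close>, so the minimal
  condition modulo \<open>J\<close> controls only the sums \<open>C n + J\<close>. What the sums
  miss is \<open>C n \<inter> J\<close>, which \<open>inter\<close> controls; the modular law
  combines the two.\<close>

lemma terminates_if_terminates_inter:
  assumes min: "\<And>D. descending_chain (abelian_ideal K (quotient_algebra L J)) D \<Longrightarrow> terminates D"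
    and J: "leibniz_ideal K L J"
    and C: "descending_chain (leibniz_ideal K L) C"
    and brackets: "\<And>n a b. \<lbrakk>n \<ge> 1; a \<in> C n; b \<in> C n\<rbrakk> \<Longrightarrow> a \<otimes>\<^bsub>L\<^esub> b \<in> J"
    and inter: "terminates (\<lambda>n. C n \<inter> J)"
  shows "terminates C"
proof -
  interpret J: leibniz_quotient K L J
    by unfold_locales (rule J)
  have id: "leibniz_ideal K L (C n)" if "n \<ge> 1" for n
    using C that by (simp add: descending_chain_def)
  have "terminates (\<lambda>n. C n <+>\<^bsub>L\<^esub> J)"
  proof (rule J.terminates_if_abelian_mod[OF min])
    have "C (Suc n) <+>\<^bsub>L\<^esub> J \<subseteq> C n <+>\<^bsub>L\<^esub> J" if "n \<ge> 1" for n
      using C that by (auto simp: descending_chain_def set_add_iff) blast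
    then show "descending_chain (leibniz_ideal K L) (\<lambda>n. C n <+>\<^bsub>L\<^esub> J)"
      using ideal_set_add[OF id J] by (simp add: descending_chain_def)
    show "J \<subseteq> C n <+>\<^bsub>L\<^esub> J" if "n \<ge> 1" for n
      by (rule subset_set_add(2)[OF idealD(1)[OF id[OF that]] idealD(1)[OF J]])
    show "x \<otimes>\<^bsub>L\<^esub> y \<in> J"
      if n: "n \<ge> 1" and xy: "x \<in> C n <+>\<^bsub>L\<^esub> J" "y \<in> C n <+>\<^bsub>L\<^esub> J" for n x y
    proof -
      obtain a i b j where e: "a \<in> C n" "i \<in> J" "x = a \<oplus>\<^bsub>L\<^esub> i" "b \<in> C n" "j \<in> J" "y = b \<oplus>\<^bsub>L\<^esub> j"
        using xy by (auto simp: set_add_iff)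
      have c: "a \<in> carrier L" "i \<in> carrier L" "b \<in> carrier L" "j \<in> carrier L"
        using e idealD(2)[OF J] idealD(2)[OF id[OF n]] by auto
      \<comment> \<open>The first summand lies in \<open>J\<close> by \<open>brackets\<close>; the
        other two have a factor in the ideal \<open>J\<close>.\<close>
      have "x \<otimes>\<^bsub>L\<^esub> y = (a \<otimes>\<^bsub>L\<^esub> b \<oplus>\<^bsub>L\<^esub> a \<otimes>\<^bsub>L\<^esub> j) \<oplus>\<^bsub>L\<^esub> i \<otimes>\<^bsub>L\<^esub> (b \<oplus>\<^bsub>L\<^esub> j)"
        using c e bracket_closed by (simp add: bracket_add_left bracket_add_right M.a_ac)
      then show ?thesis
        using c e brackets[OF n] idealD(3,4)[OF J] by simp
    qed
  qed
  then obtain p where p: "\<And>n. n \<ge> p \<Longrightarrow> C n <+>\<^bsub>L\<^esub> J = C p <+>\<^bsub>L\<^esub> J"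
    unfolding terminates_def by blast
  obtain q where q: "q \<ge> 1" "\<And>n. n \<ge> q \<Longrightarrow> C n \<inter> J = C q \<inter> J"
    using inter unfolding terminates_def by blast
  \<comment> \<open>From here on sums and intersections are both stable, and
    \<open>q \<ge> 1\<close> keeps \<open>?m\<close> among the indices at which \<open>C\<close>
    consists of ideals.\<close>
  let ?m = "max p q"
  have "C ?m = C n" if n: "n \<ge> ?m" for n
  proof (rule submodule_modular_eq)
    show "submodule (C ?m) K L" "submodule (C n) K L" "submodule J K L"
      using q(1) n by (auto intro!: idealD(1) id J)
    show "C n \<subseteq> C ?m"
      using q(1) n by (intro descending_chain_antimono[OF C]) auto
    show "C ?m \<inter> J = C n \<inter> J" "C ?m <+>\<^bsub>L\<^esub> J = C n <+>\<^bsub>L\<^esub> J"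
      using n p[of ?m] p[of n] q(2)[of ?m] q(2)[of n] by auto
  qed
  then show ?thesis
    unfolding terminates_def using q(1) by (intro exI[of _ ?m]) auto
qed

lemma quasi_artinian_terminates:
  assumes min: "\<And>J D. \<lbrakk>leibniz_ideal K L J;
        descending_chain (abelian_ideal K (quotient_algebra L J)) D\<rbrakk> \<Longrightarrow> terminates D"
    and lqa: "left_quasi_artinian K L"
    and C: "descending_chain (leibniz_ideal K L) C"
  shows "terminates C"
proof -
  let ?D = "derived_series K L"
  have id: "leibniz_ideal K L (C n)" if "n \<ge> 1" for n
    using C that by (simp add: descending_chain_def)
  obtain m where m: "m \<ge> 1" "\<And>n. n \<ge> 1 \<Longrightarrow> bracket_span K L (?D m) (C m) \<subseteq> C n"
    using lqa C unfolding left_quasi_artinian_def by blast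
  \<comment> \<open>The bound in \<open>m\<close> holds for all \<open>n \<ge> 1\<close> at once, so
    brackets of \<open>?D m\<close> with \<open>C m\<close> fall into this intersection.\<close>
  define J where "J = (\<Inter>n\<in>{1..}. C n)"
  have J: "leibniz_ideal K L J"
    unfolding J_def using id by (intro ideal_Inter) auto
  \<comment> \<open>Used with \<open>l = m\<close> for the base of the descent and with
    \<open>l = 0\<close> for its steps.\<close>
  have chain: "descending_chain (leibniz_ideal K L) (\<lambda>n. C (n + l) \<inter> ?D k)" for k l
    unfolding descending_chain_def
  proof (intro conjI allI impI)
    fix n :: nat assume "n \<ge> 1"
    then show "leibniz_ideal K L (C (n + l) \<inter> ?D k)"
      by (intro ideal_inter ideal_derived_series id) simp
    show "C (Suc n + l) \<inter> ?D k \<subseteq> C (n + l) \<inter> ?D k"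
      using descending_chain_antimono[OF C, of "n + l" "Suc n + l"] \<open>n \<ge> 1\<close> by auto
  qed
  \<comment> \<open>The shift by \<open>m\<close> puts every member inside both \<open>C m\<close>
    and \<open>?D m\<close>, so a bracket of two elements of a member is one of \<open>?D m\<close>
    with \<open>C m\<close>.\<close>
  have "terminates (\<lambda>n. C (n + m) \<inter> ?D m)"
  proof (rule terminates_if_terminates_inter[OF min[OF J] J chain])
    fix n a b assume ab: "n \<ge> 1" "a \<in> C (n + m) \<inter> ?D m" "b \<in> C (n + m) \<inter> ?D m"
    then have "b \<in> C m"
      using descending_chain_antimono[OF C m(1), of "n + m"] by auto
    then show "a \<otimes>\<^bsub>L\<^esub> b \<in> J"
      unfolding J_def using m(2) ab bracket_span_contains by blast
  next
    \<comment> \<open>\<open>J\<close> lies in every \<open>C (n + m)\<close>, since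
      \<open>m \<ge> 1\<close>; hence this chain is constant.\<close>
    have "C (n + m) \<inter> ?D m \<inter> J = ?D m \<inter> J" for n
      unfolding J_def using m(1) by auto
    then show "terminates (\<lambda>n. C (n + m) \<inter> ?D m \<inter> J)"
      by (auto simp: terminates_def)
  qed
  then have base: "terminates (\<lambda>n. C n \<inter> ?D m)"
    by (rule terminates_shift)
  \<comment> \<open>Downward induction from \<open>m\<close>: the step passes from
    \<open>Suc k\<close> to \<open>k\<close>, working modulo the ideal
    \<open>?D (Suc k)\<close>.\<close>
  have "terminates (\<lambda>n. C n \<inter> ?D 0)"
    using le0[of m]
  proof (induction rule: inc_induct)
    case (step k)
    show ?case
    proof (rule terminates_if_terminates_inter
        [OF min[OF ideal_derived_series[of "Suc k"]] ideal_derived_series])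
      show "descending_chain (leibniz_ideal K L) (\<lambda>n. C n \<inter> ?D k)"
        using chain[of 0] by simp
      show "a \<otimes>\<^bsub>L\<^esub> b \<in> ?D (Suc k)" if "a \<in> C n \<inter> ?D k" "b \<in> C n \<inter> ?D k" for n a b
        using that bracket_span_contains by simp
      \<comment> \<open>The derived series descends, so \<open>?D k\<close> is absorbed and the
        induction hypothesis remains.\<close>
      have "C n \<inter> ?D k \<inter> ?D (Suc k) = C n \<inter> ?D (Suc k)" for n
        using derived_series_Suc_subset by blast
      then show "terminates (\<lambda>n. C n \<inter> ?D k \<inter> ?D (Suc k))"
        using step.IH by simp
    qed
  qed (rule base)
  then show ?thesis
  proof (rule terminates_cong)
    \<comment> \<open>\<open>?D 0\<close> is the carrier.\<close>
    show "C n = C n \<inter> ?D 0" if "n \<ge> 1" for n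
      using idealD(2)[OF id[OF that]] by auto
  qed
qed

text \<open>The index \<open>m\<close> at which the chain becomes constant serves on both sides:
  \<open>C m\<close> then lies in every \<open>C n\<close>, and as an ideal it absorbs brackets with
  elements of the derived series.\<close>

lemma artinian_imp_quasi_artinian:
  assumes "\<And>C. descending_chain (leibniz_ideal K L) C \<Longrightarrow> terminates C"
  shows "left_quasi_artinian K L" "right_quasi_artinian K L"
proof -
  have "\<exists>m\<ge>1. \<forall>n\<ge>1. bracket_span K L (derived_series K L m) (C m) \<subseteq> C n \<and>
          bracket_span K L (C m) (derived_series K L m) \<subseteq> C n"
    if C: "descending_chain (leibniz_ideal K L) C" for C
  proof -
    obtain m where m: "m \<ge> 1" "\<And>n. n \<ge> m \<Longrightarrow> C n = C m"
      using assms[OF C] unfolding terminates_def by blast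
    have "C m \<subseteq> C n" if "n \<ge> 1" for n
      using m(2)[of n] descending_chain_antimono[OF C that, of m] by (cases "n \<ge> m") auto
    moreover have "bracket_span K L (derived_series K L m) (C m) \<subseteq> C m"
         "bracket_span K L (C m) (derived_series K L m) \<subseteq> C m"
    proof -
      have Cm: "leibniz_ideal K L (C m)"
        using C m(1) by (simp add: descending_chain_def)
      show "bracket_span K L (derived_series K L m) (C m) \<subseteq> C m"
           "bracket_span K L (C m) (derived_series K L m) \<subseteq> C m"
        using idealD[OF Cm] idealD(2)[OF ideal_derived_series[of m]]
        by (intro bracket_span_subset; blast)+
    qed
    ultimately show ?thesis using m(1) by blast
  qed
  then show "left_quasi_artinian K L" "right_quasi_artinian K L"
    unfolding left_quasi_artinian_def right_quasi_artinian_def by blast+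
qed

end

text \<open>From left to right, quotients inherit the Artinian condition, and chains of abelian
  ideals are chains of ideals. The converse is \<open>quasi_artinian_terminates\<close>, with the
  quotients by all ideals \<open>J\<close> supplying its minimal condition.\<close>

lemma artinian_class_eq:
  "(artinian_class K :: ('k, 'b) module set) =
     quotient_class K (min_abelian_class K) \<inter> quasi_artinian_class K"
proof (intro subset_antisym subsetI)
  fix L :: "('k, 'b) module"
  assume "L \<in> artinian_class K"
  then have L: "leibniz_algebra K L"
    and art: "\<And>C. descending_chain (leibniz_ideal K L) C \<Longrightarrow> terminates C"
    by (auto simp: artinian_class_def)
  interpret plain_leibniz_algebra K L by (intro plain_leibniz_algebra.intro L)
  have "quotient_algebra L I \<in> min_abelian_class K" if "leibniz_ideal K L I" for I
  proof -
    interpret leibniz_quotient K L I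
      by unfold_locales (rule that)
    have "terminates D" if "descending_chain (abelian_ideal K Q) D" for D
      using that
      by (intro artinian_quotient[OF art]) (auto simp: descending_chain_def abelian_ideal_def)
    then show ?thesis
      using quotient_leibniz_algebra by (simp add: min_abelian_class_def)
  qed
  then show "L \<in> quotient_class K (min_abelian_class K) \<inter> quasi_artinian_class K"
    using L artinian_imp_quasi_artinian[OF art]
    by (simp add: quotient_class_def quasi_artinian_class_def)
next
  fix L :: "('k, 'b) module"
  assume *: "L \<in> quotient_class K (min_abelian_class K) \<inter> quasi_artinian_class K"
  then interpret plain_leibniz_algebra K L
    by (simp add: plain_leibniz_algebra_def quasi_artinian_class_def)
  have "terminates C" if "descending_chain (leibniz_ideal K L) C" for C
    using * that
    by (intro quasi_artinian_terminates)
      (auto simp: quotient_class_def min_abelian_class_def quasi_artinian_class_def)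
  then show "L \<in> artinian_class K"
    using leibniz_algebra_axioms by (simp add: artinian_class_def)
qed

text \<open>The first conjunct is the equality of classes read at one quasi-Artinian
  \<open>L\<close>, whose membership already provides the Leibniz axioms that
  \<open>quotient_class\<close> asks for.\<close>

theorem theorem4p3:
  fixes K :: "('k, 'r) ring_scheme"
  assumes "field K"
  shows "(\<forall>L :: ('k, 'b) module. L \<in> quasi_artinian_class K \<longrightarrow>
           (L \<in> artinian_class K \<longleftrightarrow>
            (\<forall>I. leibniz_ideal K L I \<longrightarrow> quotient_algebra L I \<in> min_abelian_class K))) \<and>
         (artinian_class K :: ('k, 'b) module set) =
           quotient_class K (min_abelian_class K) \<inter> quasi_artinian_class K"
  by (auto simp: artinian_class_eq quotient_class_def quasi_artinian_class_def)

end
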